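(* Let $a<b$ be two real numbers and let $f:[a,b]\to\mathbb{R}$ be a function. Then the following five assertions are equivalent: ($\alpha$) the set of the discontinuity points of $f$ is Lebesgue-negligible; ($\beta$) the set of the left-hand discontinuity points of $f$ (points of $(a,b]$ at which $f$ is not left-hand continuous) is Lebesgue-negligible; ($\gamma$) the set of the right-hand discontinuity points of $f$ (points of $[a,b)$ at which $f$ is not right-hand continuous) is Lebesgue-negligible; ($\delta$) the set of the points of $(a,b]$ where $f$ does not admit a finite left-hand limit is Lebesgue-negligible; ($\epsilon$) the set of the points of $[a,b)$ where $f$ does not admit a finite right-hand limit is Lebesgue-negligible. Likewise, the five assertions obtained from ($\alpha$)--($\epsilon$) by replacing "Lebesgue-negligible" by "at most countable" in every one of them are equivalent to each other.
   Context: A subset $N\subset[a,b]$ is called Lebesgue-negligible when there exists a Borel subset $B$ of $[a,b]$ such that $N\subset B$ and $\mu(B)=0$, where $\mu$ is the Lebesgue measure on $\mathbb{R}$. One-sided limits are $f(x-):=\lim_{y\to x,\,y<x}f(y)$ for $x\in(a,b]$ (left-hand) and $f(x+):=\lim_{y\to x,\,y>x}f(y)$ for $x\in[a,b)$ (right-hand); the point $x$ itself is excluded. $f$ is left-hand continuous at $x\in(a,b]$ if $f(x-)$ exists and equals $f(x)$, and right-hand continuous at $x\in[a,b)$ if $f(x+)$ exists and equals $f(x)$. *)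

theory Defs
  imports "HOL-Analysis.Analysis"
begin

definition Lebesgue_negligible_on :: "real \<Rightarrow> real \<Rightarrow> real set \<Rightarrow> bool" where
  "Lebesgue_negligible_on a b N \<longleftrightarrow>
     (\<exists>B. B \<in> sets borel \<and> B \<subseteq> {a..b} \<and> N \<subseteq> B \<and> emeasure lborel B = 0)"

text \<open>This agrees with the library notion of a negligible set.\<close>

lemma Lebesgue_negligible_on_iff_negligible:
  "Lebesgue_negligible_on a b N \<longleftrightarrow> N \<subseteq> {a..b} \<and> negligible N"
proof
  assume "Lebesgue_negligible_on a b N"
  then obtain B where B: "B \<in> sets borel" "B \<subseteq> {a..b}" "N \<subseteq> B" "emeasure lborel B = 0"
    by (auto simp: Lebesgue_negligible_on_def)
  then have "B \<in> null_sets lborel"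
    by (auto simp: null_sets_def)
  with B(3) have "N \<in> null_sets lebesgue"
    by (auto simp: null_sets_completion_iff2)
  with B show "N \<subseteq> {a..b} \<and> negligible N"
    by (auto simp: negligible_iff_null_sets)
next
  assume N: "N \<subseteq> {a..b} \<and> negligible N"
  then obtain B where B: "B \<in> null_sets lborel" "N \<subseteq> B"
    by (auto simp: negligible_iff_null_sets null_sets_completion_iff2)
  have "B \<inter> {a..b} \<in> null_sets lborel"
    using B(1) by (intro null_set_Int2) auto
  with N B show "Lebesgue_negligible_on a b N"
    unfolding Lebesgue_negligible_on_def
    by (intro exI[of _ "B \<inter> {a..b}"]) (auto simp: null_sets_def)
qed

text \<open>A function on \<open>[a, b]\<close> is represented by a total function on the reals, and nothing below
  depends on its values outside \<open>[a, b]\<close>: two-sided continuity is relative to the interval, and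
  near a point \<open>x\<close> of \<open>(a, b]\<close> the filter \<open>at_left x\<close> only sees points of \<open>[a, x)\<close> (similarly
  \<open>at_right x\<close> for \<open>x\<close> in \<open>[a, b)\<close>). Neither one-sided filter includes \<open>x\<close> itself.\<close>

definition discontinuities :: "real \<Rightarrow> real \<Rightarrow> (real \<Rightarrow> real) \<Rightarrow> real set" where
  "discontinuities a b f = {x \<in> {a..b}. \<not> continuous (at x within {a..b}) f}"

definition left_discontinuities :: "real \<Rightarrow> real \<Rightarrow> (real \<Rightarrow> real) \<Rightarrow> real set" where
  "left_discontinuities a b f = {x \<in> {a<..b}. \<not> continuous (at_left x) f}"

definition right_discontinuities :: "real \<Rightarrow> real \<Rightarrow> (real \<Rightarrow> real) \<Rightarrow> real set" where
  "right_discontinuities a b f = {x \<in> {a..<b}. \<not> continuous (at_right x) f}"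

definition no_left_limit_points :: "real \<Rightarrow> real \<Rightarrow> (real \<Rightarrow> real) \<Rightarrow> real set" where
  "no_left_limit_points a b f = {x \<in> {a<..b}. \<not> (\<exists>l::real. (f \<longlongrightarrow> l) (at_left x))}"

definition no_right_limit_points :: "real \<Rightarrow> real \<Rightarrow> (real \<Rightarrow> real) \<Rightarrow> real set" where
  "no_right_limit_points a b f = {x \<in> {a..<b}. \<not> (\<exists>l::real. (f \<longlongrightarrow> l) (at_right x))}"

end

theory Submission
  imports Defs
begin

text \<open>Fix \<open>e > 0\<close> and call \<open>x\<close> bad if the oscillation of \<open>f\<close> at \<open>x\<close> is at least \<open>e\<close>. If \<open>f\<close> has a finite
  left-hand limit at \<open>x\<close>, then \<open>f\<close> varies by less than \<open>e\<close> on some interval \<open>(y, x)\<close>, which therefore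
  contains no bad point. The bad points having a left-hand limit thus form a set isolated from the
  left, and such a set is countable. Letting \<open>e\<close> run through \<open>1/n\<close>, all but countably many
  discontinuities are points without a left-hand limit; symmetrically on the right. Since such
  points are one-sided discontinuities, which in turn are discontinuities, the sets in question
  differ pairwise by countable sets.\<close>

text \<open>Phrasing oscillation through pairs of points avoids an infimum of suprema, which may be
  infinite. As suprema need not be attained, the set lies between the points of oscillation
  \<open>> e\<close> and those of oscillation \<open>\<ge> e\<close>.\<close>

definition large_oscillation_points :: "real \<Rightarrow> real \<Rightarrow> (real \<Rightarrow> real) \<Rightarrow> real \<Rightarrow> real set" where
  "large_oscillation_points a b f e =
     {x \<in> {a..b}. \<forall>d>0. \<exists>u\<in>{a..b}. \<exists>v\<in>{a..b}. \<bar>u - x\<bar> < d \<and> \<bar>v - x\<bar> < d \<and> e \<le> \<bar>f u - f v\<bar>}"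

text \<open>The gaps to the left of distinct points of \<open>S\<close> are disjoint, so a rational
  chosen in each gap gives an injection of \<open>S\<close> into the rationals.\<close>

lemma countable_left_isolated:
  fixes S :: "real set"
  assumes "\<And>x. x \<in> S \<Longrightarrow> \<exists>y<x. {y<..<x} \<inter> S = {}"
  shows "countable S"
proof -
  obtain y where y: "\<And>x. x \<in> S \<Longrightarrow> y x < x \<and> {y x<..<x} \<inter> S = {}"
    using assms by metis
  have "\<exists>q::rat. y x < of_rat q \<and> of_rat q < x" if "x \<in> S" for x
    using y[OF that] of_rat_dense by blast
  then obtain q :: "real \<Rightarrow> rat" where q: "\<And>x. x \<in> S \<Longrightarrow> y x < of_rat (q x) \<and> of_rat (q x) < x"
    by metis
  have "q u \<noteq> q v" if "u \<in> S" "v \<in> S" "u < v" for u v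
  proof -
    \<comment> \<open>Otherwise \<open>u\<close> would be a point of \<open>S\<close> inside the gap
      of \<open>v\<close>. Hence the rational of \<open>u\<close> lies below
      \<open>u \<le> y v\<close> and that of \<open>v\<close> above \<open>y v\<close>.\<close>
    have "u \<le> y v"
      using y[OF that(2)] that by (force simp: disjoint_iff not_less)
    then show ?thesis
      using q[OF that(1)] q[OF that(2)] by force
  qed
  then have "inj_on q S"
    by (metis inj_onI linorder_less_linear)
  then show ?thesis
    using countableI_type countable_image_inj_on by blast
qed

text \<open>The reflection \<open>uminus\<close> exchanges left and right gaps and is
  injective.\<close>

lemma countable_right_isolated:
  fixes S :: "real set"
  assumes "\<And>x. x \<in> S \<Longrightarrow> \<exists>y>x. {x<..<y} \<inter> S = {}"
  shows "countable S"
proof -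
  have "countable (uminus ` S)"
  proof (rule countable_left_isolated)
    fix x assume "x \<in> uminus ` S"
    then obtain y where y: "y > -x" "{-x<..<y} \<inter> S = {}"
      using assms by force
    have "{-y<..<x} \<inter> uminus ` S = {}"
    proof (rule ccontr)
      assume "{-y<..<x} \<inter> uminus ` S \<noteq> {}"
      then obtain s where "s \<in> S" "-y < -s" "-s < x"
        by auto
      then have "s \<in> {-x<..<y} \<inter> S"
        by auto
      with y(2) show False
        by simp
    qed
    with y(1) show "\<exists>z<x. {z<..<x} \<inter> uminus ` S = {}"
      by (intro exI[of _ "-y"]) auto
  qed
  then show ?thesis
    by (rule countable_image_inj_on) simp
qed

text \<open>By contraposition: if \<open>x\<close> avoids every level, then for given
  \<open>e\<close> a level \<open>inverse (real (Suc n)) < e\<close> supplies the \<open>d\<close>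
  of the continuity criterion.\<close>

lemma discontinuities_subset_large_oscillation:
  "discontinuities a b f \<subseteq> (\<Union>n. large_oscillation_points a b f (inverse (real (Suc n))))"
proof
  fix x assume x: "x \<in> discontinuities a b f"
  show "x \<in> (\<Union>n. large_oscillation_points a b f (inverse (real (Suc n))))"
  proof (rule ccontr)
    assume neg: "\<not> ?thesis"
    have "continuous (at x within {a..b}) f"
      unfolding continuous_within_eps_delta
    proof (intro allI impI)
      fix e :: real assume "e > 0"
      then obtain n where n: "inverse (real (Suc n)) < e"
        using reals_Archimedean by blast
      obtain d where d: "d > 0" "\<And>u v. \<lbrakk>u \<in> {a..b}; v \<in> {a..b}; \<bar>u - x\<bar> < d; \<bar>v - x\<bar> < d\<rbrakk>
          \<Longrightarrow> \<bar>f u - f v\<bar> < inverse (real (Suc n))"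
      proof -
        have "x \<in> {a..b}" "x \<notin> large_oscillation_points a b f (inverse (real (Suc n)))"
          using neg x by (auto simp: discontinuities_def)
        then show ?thesis
          unfolding large_oscillation_points_def using that by (auto simp del: of_nat_Suc simp: not_le)
      qed
      have "dist (f u) (f x) < e" if "u \<in> {a..b}" "dist u x < d" for u
      proof -
        have "\<bar>f u - f x\<bar> < inverse (real (Suc n))"
          using d that x by (intro d(2)) (auto simp: dist_real_def discontinuities_def)
        with n show ?thesis
          by (simp add: dist_real_def)
      qed
      with d(1) show "\<exists>d>0. \<forall>u\<in>{a..b}. dist u x < d \<longrightarrow> dist (f u) (f x) < e"
        by blast
    qed
    with x show False
      by (simp add: discontinuities_def)
  qed
qed

text \<open>Every point of an open interval has a neighbourhood inside it, where any two values are
  within \<open>e / 2\<close> of the same \<open>l\<close> and so differ by less than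
  \<open>e\<close>.\<close>

lemma large_oscillation_points_disjoint_interval:
  assumes near: "\<And>u. u \<in> {p<..<q} \<Longrightarrow> \<bar>f u - l\<bar> < e / 2"
  shows "{p<..<q} \<inter> large_oscillation_points a b f e = {}"
proof (rule ccontr)
  assume "\<not> ?thesis"
  then obtain z where z: "p < z" "z < q" "z \<in> large_oscillation_points a b f e"
    by auto
  \<comment> \<open>With this radius the neighbourhood of \<open>z\<close> stays between
    \<open>p\<close> and \<open>q\<close>.\<close>
  define d where "d = min (z - p) (q - z)"
  have "d > 0"
    using z by (simp add: d_def)
  with z(3) obtain u v where uv: "\<bar>u - z\<bar> < d" "\<bar>v - z\<bar> < d" "e \<le> \<bar>f u - f v\<bar>"
    unfolding large_oscillation_points_def by blast
  then have "u \<in> {p<..<q}" "v \<in> {p<..<q}"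
    by (auto simp: d_def)
  from near[OF this(1)] near[OF this(2)] uv(3) show False
    by linarith
qed

lemma countable_discontinuities_with_left_limit:
  "countable (discontinuities a b f - no_left_limit_points a b f)"
proof -
  let ?S = "\<lambda>n. large_oscillation_points a b f (inverse (real (Suc n)))
                  \<inter> {x. \<exists>l. (f \<longlongrightarrow> l) (at_left x)}"
  have "countable (?S n)" for n
  proof (rule countable_left_isolated)
    fix x assume "x \<in> ?S n"
    then obtain l where "(f \<longlongrightarrow> l) (at_left x)"
      by blast
    then have "\<forall>\<^sub>F u in at_left x. \<bar>f u - l\<bar> < inverse (real (Suc n)) / 2"
      by (auto dest!: tendstoD[where e = "inverse (real (Suc n)) / 2"] simp: dist_real_def)
    then obtain y where y: "y < x" "\<And>u. \<lbrakk>y < u; u < x\<rbrakk> \<Longrightarrow> \<bar>f u - l\<bar> < inverse (real (Suc n)) / 2"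
      unfolding eventually_at_left_field by blast
    have "{y<..<x} \<inter> large_oscillation_points a b f (inverse (real (Suc n))) = {}"
      using y(2) by (intro large_oscillation_points_disjoint_interval[where l = l]) auto
    with y(1) show "\<exists>y<x. {y<..<x} \<inter> ?S n = {}"
      by blast
  qed
  \<comment> \<open>The endpoint \<open>a\<close> is never in \<open>no_left_limit_points\<close>,
    so it can be a discontinuity outside that set without \<open>f\<close> having a limit along
    \<open>at_left a\<close>. It is therefore added by hand.\<close>
  then have "countable (insert a (\<Union>n. ?S n))"
    by (intro countable_insert countable_UN countableI_type)
  moreover have "discontinuities a b f - no_left_limit_points a b f \<subseteq> insert a (\<Union>n. ?S n)"
  proof
    fix x assume x: "x \<in> discontinuities a b f - no_left_limit_points a b f"
    then obtain n where "x \<in> large_oscillation_points a b f (inverse (real (Suc n)))"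
      using discontinuities_subset_large_oscillation by blast
    with x show "x \<in> insert a (\<Union>n. ?S n)"
      by (force simp: discontinuities_def no_left_limit_points_def)
  qed
  ultimately show ?thesis
    by (rule countable_subset[rotated])
qed

lemma countable_discontinuities_with_right_limit:
  "countable (discontinuities a b f - no_right_limit_points a b f)"
proof -
  let ?S = "\<lambda>n. large_oscillation_points a b f (inverse (real (Suc n)))
                  \<inter> {x. \<exists>l. (f \<longlongrightarrow> l) (at_right x)}"
  have "countable (?S n)" for n
  proof (rule countable_right_isolated)
    fix x assume "x \<in> ?S n"
    then obtain l where "(f \<longlongrightarrow> l) (at_right x)"
      by blast
    then have "\<forall>\<^sub>F u in at_right x. \<bar>f u - l\<bar> < inverse (real (Suc n)) / 2"
      by (auto dest!: tendstoD[where e = "inverse (real (Suc n)) / 2"] simp: dist_real_def)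
    then obtain y where y: "x < y" "\<And>u. \<lbrakk>x < u; u < y\<rbrakk> \<Longrightarrow> \<bar>f u - l\<bar> < inverse (real (Suc n)) / 2"
      unfolding eventually_at_right_field by blast
    have "{x<..<y} \<inter> large_oscillation_points a b f (inverse (real (Suc n))) = {}"
      using y(2) by (intro large_oscillation_points_disjoint_interval[where l = l]) auto
    with y(1) show "\<exists>y>x. {x<..<y} \<inter> ?S n = {}"
      by blast
  qed
  \<comment> \<open>Here the exceptional endpoint is \<open>b\<close>, which
    \<open>no_right_limit_points\<close> excludes.\<close>
  then have "countable (insert b (\<Union>n. ?S n))"
    by (intro countable_insert countable_UN countableI_type)
  moreover have "discontinuities a b f - no_right_limit_points a b f \<subseteq> insert b (\<Union>n. ?S n)"
  proof
    fix x assume x: "x \<in> discontinuities a b f - no_right_limit_points a b f"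
    then obtain n where "x \<in> large_oscillation_points a b f (inverse (real (Suc n)))"
      using discontinuities_subset_large_oscillation by blast
    with x show "x \<in> insert b (\<Union>n. ?S n)"
      by (force simp: discontinuities_def no_right_limit_points_def)
  qed
  ultimately show ?thesis
    by (rule countable_subset[rotated])
qed

lemma no_left_limit_points_subset: "no_left_limit_points a b f \<subseteq> left_discontinuities a b f"
  by (auto simp: no_left_limit_points_def left_discontinuities_def continuous_within)

lemma no_right_limit_points_subset: "no_right_limit_points a b f \<subseteq> right_discontinuities a b f"
  by (auto simp: no_right_limit_points_def right_discontinuities_def continuous_within)

lemma left_discontinuities_subset: "left_discontinuities a b f \<subseteq> discontinuities a b f"
proof -
  have "continuous (at_left x) f"
    if "a < x" "x \<le> b" "continuous (at x within {a..b}) f" for x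
  proof -
    \<comment> \<open>Passing to \<open>{a..x}\<close> discards the points to the right of
      \<open>x\<close>; since \<open>a < x\<close>, the filter that remains is
      \<open>at_left x\<close>.\<close>
    have "continuous (at x within {a..x}) f"
      using that by (auto intro: continuous_within_subset)
    with that(1) show ?thesis
      by (simp add: at_within_Icc_at_left)
  qed
  then show ?thesis
    by (auto simp: left_discontinuities_def discontinuities_def)
qed

lemma right_discontinuities_subset: "right_discontinuities a b f \<subseteq> discontinuities a b f"
proof -
  have "continuous (at_right x) f"
    if "a \<le> x" "x < b" "continuous (at x within {a..b}) f" for x
  proof -
    \<comment> \<open>Likewise, \<open>{x..b}\<close> leaves only \<open>at_right x\<close>, since
      \<open>x < b\<close>.\<close>
    have "continuous (at x within {x..b}) f"
      using that by (auto intro: continuous_within_subset)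
    with that(2) show ?thesis
      by (simp add: at_within_Icc_at_right)
  qed
  then show ?thesis
    by (auto simp: right_discontinuities_def discontinuities_def)
qed

lemma countable_iff_of_countable_Diff:
  assumes "N \<subseteq> D" "countable (D - N)"
  shows "countable D \<longleftrightarrow> countable N"
  using assms countable_Un[of N "D - N"] countable_subset[of N D] by (auto simp: Un_absorb1)

text \<open>A countable set is null, so \<open>D\<close> is the union of \<open>N\<close> and a null
  set. Working with \<open>negligible\<close> avoids handling Borel covers; only the inclusion in
  \<open>{a..b}\<close> has to be carried along.\<close>

lemma Lebesgue_negligible_on_iff_of_countable_Diff:
  assumes "N \<subseteq> D" "D \<subseteq> {a..b}" "countable (D - N)"
  shows "Lebesgue_negligible_on a b D \<longleftrightarrow> Lebesgue_negligible_on a b N"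
proof -
  have "negligible (D - N)"
    using countable_imp_null_set_lborel[OF assms(3)]
    by (simp add: negligible_iff_null_sets null_sets_completionI)
  with assms(1) have "negligible D \<longleftrightarrow> negligible N"
    using negligible_Un[of N "D - N"] negligible_subset[of D N] by (auto simp: Un_absorb1)
  with assms show ?thesis
    by (auto simp: Lebesgue_negligible_on_iff_negligible)
qed

theorem theorem6p1:
  fixes a b :: real and f :: "real \<Rightarrow> real"
  assumes "a < b"
  shows "((Lebesgue_negligible_on a b (discontinuities a b f)
             \<longleftrightarrow> Lebesgue_negligible_on a b (left_discontinuities a b f)) \<and>
          (Lebesgue_negligible_on a b (discontinuities a b f)
             \<longleftrightarrow> Lebesgue_negligible_on a b (right_discontinuities a b f)) \<and>
          (Lebesgue_negligible_on a b (discontinuities a b f)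
             \<longleftrightarrow> Lebesgue_negligible_on a b (no_left_limit_points a b f)) \<and>
          (Lebesgue_negligible_on a b (discontinuities a b f)
             \<longleftrightarrow> Lebesgue_negligible_on a b (no_right_limit_points a b f))) \<and>
         ((countable (discontinuities a b f) \<longleftrightarrow> countable (left_discontinuities a b f)) \<and>
          (countable (discontinuities a b f) \<longleftrightarrow> countable (right_discontinuities a b f)) \<and>
          (countable (discontinuities a b f) \<longleftrightarrow> countable (no_left_limit_points a b f)) \<and>
          (countable (discontinuities a b f) \<longleftrightarrow> countable (no_right_limit_points a b f)))"
proof -
  let ?D = "discontinuities a b f"
  have D: "?D \<subseteq> {a..b}"
    by (auto simp: discontinuities_def)
  have sub: "left_discontinuities a b f \<subseteq> ?D" "right_discontinuities a b f \<subseteq> ?D"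
      "no_left_limit_points a b f \<subseteq> ?D" "no_right_limit_points a b f \<subseteq> ?D"
    using left_discontinuities_subset right_discontinuities_subset
      no_left_limit_points_subset no_right_limit_points_subset by (meson order_trans)+
  \<comment> \<open>The one-sided discontinuities contain the points without the corresponding
    limit, so removing them from \<open>?D\<close> leaves even less.\<close>
  have "countable (?D - left_discontinuities a b f)" "countable (?D - right_discontinuities a b f)"
    using countable_discontinuities_with_left_limit countable_discontinuities_with_right_limit
      no_left_limit_points_subset no_right_limit_points_subset
    by (meson Diff_mono countable_subset order_refl)+
  note diff = this countable_discontinuities_with_left_limit
    countable_discontinuities_with_right_limit
  \<comment> \<open>Each of the eight equivalences compares \<open>?D\<close> with a subset whose
    complement in \<open>?D\<close> is countable.\<close>
  show ?thesis
    by (intro conjI Lebesgue_negligible_on_iff_of_countable_Diff countable_iff_of_countable_Diff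
        D sub diff)
qed

end
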